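(* Let $k\ge3$ and let $\Psi\subseteq\Lambda_{k,r}$ be such that every $\psi\in\Psi$ is commutative. Then the following are equivalent: (a) there is a group operation $+$ on $\Omega$ and elements $\{b_\psi\}_{\psi\in\Psi}\subseteq\Omega$ such that $\psi=\psi_{(\Omega,+),b_\psi}$ for all $\psi\in\Psi$; (b) every function in $F_2(\Psi)$ is symmetric.
   Context: $\Omega$ is a finite set of $r\ge2$ spins. A $k$-ary constraint function is $\psi:\Omega^k\to\{0,1\}$; write $\sigma\models\psi$ if $\psi(\sigma)=1$; juxtaposition of strings denotes concatenation. $\psi$ is uniquely extendable (UE) if for every $i\in[k]$ and every assignment of the other $k-1$ coordinates there is a unique spin in coordinate $i$ making the tuple satisfy $\psi$; $\Lambda_{k,r}$ is the set of $k$-ary UE constraint functions on $\Omega$. $\psi$ is commutative if $\sigma\models\psi\iff(\sigma_{\pi(1)},\dots,\sigma_{\pi(k)})\models\psi$ for all $\sigma\in\Omega^k$ and permutations $\pi$ of $[k]$. For $\psi\in\Lambda_{k,r}$, $f_\psi:\Omega^{k-1}\to\Omega$ is the unique function with $\sigma f_\psi(\sigma)\models\psi$. $F_2(\Psi)$ is the set of functions $\Omega^{(k-1)^2}\to\Omega$ of the form $\sigma_1\cdots\sigma_{k-1}\mapsto f_{\psi_0}(f_{\psi_1}(\sigma_1)\cdots f_{\psi_{k-1}}(\sigma_{k-1}))$ with $\sigma_j\in\Omega^{k-1}$ and $\psi_0,\dots,\psi_{k-1}\in\Psi$. A function is symmetric if invariant under all permutations of its arguments. For a (not necessarily abelian)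 group $(\Omega,+)$ and $b\in\Omega$, $\psi_{(\Omega,+),b}$ is the constraint with $(\sigma_1,\dots,\sigma_k)\models\psi_{(\Omega,+),b}$ iff $\sigma_1+\cdots+\sigma_k=b$. *)

theory Defs
  imports
    "HOL-Algebra.Group"
    "HOL-Combinatorics.Permutations"
    "HOL-Library.FuncSet"
begin

definition tuples :: "'a set \<Rightarrow> nat \<Rightarrow> 'a list set" where
  "tuples S n = {\<sigma>. set \<sigma> \<subseteq> S \<and> length \<sigma> = n}"

type_synonym 'a constraint = "'a list \<Rightarrow> nat"

(* Functions on tuples are extensional (undefined off their domain), so that HOL equality
   is equality of functions on that domain. *)
definition constraint_functions :: "nat \<Rightarrow> 'a set \<Rightarrow> 'a constraint set" where
  "constraint_functions k \<Omega> = (tuples \<Omega> k \<rightarrow>\<^sub>E {0, 1})"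

definition models :: "'a list \<Rightarrow> 'a constraint \<Rightarrow> bool" (infix "\<Turnstile>" 50) where
  "\<sigma> \<Turnstile> \<psi> \<longleftrightarrow> \<psi> \<sigma> = 1"

(* The coordinate singled out is i (counted from 0): \<tau> and \<rho> together assign the other
   k - 1 coordinates. *)
definition uniquely_extendable :: "nat \<Rightarrow> 'a set \<Rightarrow> 'a constraint \<Rightarrow> bool" where
  "uniquely_extendable k \<Omega> \<psi> \<longleftrightarrow>
     (\<forall>i<k. \<forall>\<tau>\<in>tuples \<Omega> i. \<forall>\<rho>\<in>tuples \<Omega> (k - 1 - i). \<exists>!x. x \<in> \<Omega> \<and> \<tau> @ [x] @ \<rho> \<Turnstile> \<psi>)"

definition UE :: "nat \<Rightarrow> 'a set \<Rightarrow> 'a constraint set" where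
  "UE k \<Omega> = {\<psi> \<in> constraint_functions k \<Omega>. uniquely_extendable k \<Omega> \<psi>}"

definition commutative_constraint :: "nat \<Rightarrow> 'a set \<Rightarrow> 'a constraint \<Rightarrow> bool" where
  "commutative_constraint k \<Omega> \<psi> \<longleftrightarrow>
     (\<forall>\<sigma>\<in>tuples \<Omega> k. \<forall>\<pi>. \<pi> permutes {..<k} \<longrightarrow> (\<sigma> \<Turnstile> \<psi> \<longleftrightarrow> permute_list \<pi> \<sigma> \<Turnstile> \<psi>))"

(* f_\<psi>; used only for \<psi> in UE k \<Omega> and \<sigma> of length k - 1 *)
definition ext_fun :: "'a set \<Rightarrow> 'a constraint \<Rightarrow> 'a list \<Rightarrow> 'a" where
  "ext_fun \<Omega> \<psi> \<sigma> = (THE x. x \<in> \<Omega> \<and> \<sigma> @ [x] \<Turnstile> \<psi>)"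

(* Every tuple of length (k - 1)^2 is concat \<sigma>s for exactly one list \<sigma>s of k - 1 blocks of
   length k - 1, so \<psi>0 and \<psi>s determine F. *)
definition F2 :: "nat \<Rightarrow> 'a set \<Rightarrow> 'a constraint set \<Rightarrow> ('a list \<Rightarrow> 'a) set" where
  "F2 k \<Omega> \<Psi> =
     {F \<in> tuples \<Omega> ((k - 1)\<^sup>2) \<rightarrow>\<^sub>E \<Omega>.
        \<exists>\<psi>0\<in>\<Psi>. \<exists>\<psi>s\<in>tuples \<Psi> (k - 1). \<forall>\<sigma>s\<in>tuples (tuples \<Omega> (k - 1)) (k - 1).
          F (concat \<sigma>s) = ext_fun \<Omega> \<psi>0 (map2 (ext_fun \<Omega>) \<psi>s \<sigma>s)}"

definition symmetric_fun :: "nat \<Rightarrow> 'a set \<Rightarrow> ('a list \<Rightarrow> 'b) \<Rightarrow> bool" where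
  "symmetric_fun n \<Omega> F \<longleftrightarrow>
     (\<forall>\<sigma>\<in>tuples \<Omega> n. \<forall>\<pi>. \<pi> permutes {..<n} \<longrightarrow> F (permute_list \<pi> \<sigma>) = F \<sigma>)"

(* The group is written multiplicatively, as in HOL-Algebra; it need not be abelian, so the
   product is taken in the order of the list. *)
definition group_constraint :: "nat \<Rightarrow> ('a, 'm) monoid_scheme \<Rightarrow> 'a \<Rightarrow> 'a constraint" where
  "group_constraint k G b =
     (\<lambda>\<sigma>\<in>tuples (carrier G) k. if foldr (\<otimes>\<^bsub>G\<^esub>) \<sigma> \<one>\<^bsub>G\<^esub> = b then 1 else 0)"

end

theory Submission
  imports
    Defs
    "HOL-Algebra.Divisibility"
    "HOL-Algebra.Elementary_Groups"
    "HOL-Algebra.Weak_Morphisms"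
begin

text \<open>
  Fix \<open>z \<in> \<Omega>\<close> and \<open>\<psi> \<in> \<Psi>\<close>, and let \<open>f = f\<^sub>\<psi>\<close> and \<open>S x = f (x, z, \<dots>, z)\<close>. Since \<open>\<psi>\<close> is invariant
  under permutations, exchanging the output of \<open>f\<close> with one of its inputs is possible, so \<open>S\<close> is an
  involution. The sum is defined by \<open>S (x + y) = f (x, y, z, \<dots>, z)\<close>, with neutral element \<open>z\<close>.
  Symmetry of the function \<open>f (f _, f _, c, \<dots>, c)\<close>, where \<open>c = f (z, \<dots>, z)\<close>, lets entries move
  between the two inner blocks; this gives associativity and \<open>f \<sigma> = S z - \<Sum>\<sigma>\<close>. For any other
  \<open>\<psi>' \<in> \<Psi>\<close>, moving all entries of \<open>\<sigma>\<close> from the first block to the second in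
  \<open>f (f\<^bsub>\<psi>'\<^esub> \<sigma>, c, c, \<dots>, c)\<close> gives \<open>f\<^bsub>\<psi>'\<^esub> \<sigma> = f\<^bsub>\<psi>'\<^esub> (z, \<dots>, z) - \<Sum>\<sigma>\<close>.
  Conversely, since \<open>k \<ge> 3\<close>, commutativity of one constraint given by a group makes the group abelian.
\<close>

section \<open>Tuples and symmetric functions\<close>

lemma tuples_0 [simp]: "tuples S 0 = {[]}"
  by (auto simp: tuples_def)

lemma Cons_in_tuples_Suc [simp]: "x # xs \<in> tuples S (Suc n) \<longleftrightarrow> x \<in> S \<and> xs \<in> tuples S n"
  by (auto simp: tuples_def)

lemma replicate_in_tuples [simp]: "x \<in> S \<Longrightarrow> replicate n x \<in> tuples S n"
  by (auto simp: tuples_def)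

lemma append_in_tuples: "xs \<in> tuples S m \<Longrightarrow> ys \<in> tuples S n \<Longrightarrow> xs @ ys \<in> tuples S (m + n)"
  by (auto simp: tuples_def)

lemma concat_in_tuples: "\<sigma>s \<in> tuples (tuples S n) m \<Longrightarrow> concat \<sigma>s \<in> tuples S (m * n)"
proof (induction \<sigma>s arbitrary: m)
  case (Cons \<sigma> \<sigma>s)
  then obtain m' where m: "m = Suc m'" by (cases m) (auto simp: tuples_def)
  with Cons have "\<sigma> \<in> tuples S n" "concat \<sigma>s \<in> tuples S (m' * n)" by simp_all
  then show ?case using append_in_tuples m by fastforce
qed (simp add: tuples_def)

text \<open>Cutting off the first \<open>n\<close> entries again and again gives a block
  decomposition of every flat tuple. With the injectivity of \<open>concat\<close> below, a function
  in \<open>F2\<close> may be handled through its values on lists of blocks.\<close>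

lemma tuples_eq_concat_image: "tuples S (m * n) = concat ` tuples (tuples S n) m"
proof
  show "tuples S (m * n) \<subseteq> concat ` tuples (tuples S n) m"
  proof (induction m)
    case 0
    show ?case by simp
  next
    case (Suc m)
    show ?case
    proof
      fix xs assume xs: "xs \<in> tuples S (Suc m * n)"
      then have t: "take n xs \<in> tuples S n"
        and "drop n xs \<in> tuples S (m * n)"
        by (auto simp: tuples_def dest: in_set_takeD in_set_dropD)
      then obtain \<sigma>s where s: "\<sigma>s \<in> tuples (tuples S n) m" "drop n xs = concat \<sigma>s"
        using Suc by blast
      then have "xs = concat (take n xs # \<sigma>s)"
        by (simp flip: s(2))
      moreover have "take n xs # \<sigma>s \<in> tuples (tuples S n) (Suc m)"
        using t s by simp
      ultimately show "xs \<in> concat ` tuples (tuples S n) (Suc m)"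
        by blast
    qed
  qed
next
  show "concat ` tuples (tuples S n) m \<subseteq> tuples S (m * n)"
    by (intro image_subsetI concat_in_tuples)
qed

text \<open>All blocks have the same length, so the cutting points are determined by the flat
  list.\<close>

lemma inj_on_concat_tuples: "inj_on concat (tuples (tuples S n) m)"
proof (rule inj_onI)
  fix xs ys
  assume xs: "xs \<in> tuples (tuples S n) m" and ys: "ys \<in> tuples (tuples S n) m"
    and eq: "concat xs = concat ys"
  show "xs = ys"
  proof (rule concat_injective[OF eq])
    show "length xs = length ys" using xs ys by (simp add: tuples_def)
    show "\<forall>(x, y)\<in>set (zip xs ys). length x = length y"
    proof safe
      fix a b assume "(a, b) \<in> set (zip xs ys)"
      then have "a \<in> set xs" "b \<in> set ys" by (auto dest: set_zip_leftD set_zip_rightD)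
      then have "a \<in> tuples S n" "b \<in> tuples S n" using xs ys by (auto simp: tuples_def[of "tuples S n"])
      then show "length a = length b" by (simp add: tuples_def)
    qed
  qed
qed

text \<open>Rearrangements are compared by multisets from here on, so that no permutation has to be
  written down.\<close>

lemma symmetric_funD_mset:
  assumes "symmetric_fun n \<Omega> F" "xs \<in> tuples \<Omega> n" "mset xs = mset ys"
  shows "F xs = F ys"
proof -
  from assms(3) have "mset ys = mset xs" by simp
  then obtain p where p: "p permutes {..<length xs}" "permute_list p xs = ys"
    by (rule mset_eq_permutation)
  then show ?thesis
    using assms(1,2) by (auto simp: symmetric_fun_def tuples_def)
qed

lemma commutative_constraint_mset:
  assumes "commutative_constraint k \<Omega> \<psi>" "xs \<in> tuples \<Omega> k" "mset xs = mset ys"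
  shows "xs \<Turnstile> \<psi> \<longleftrightarrow> ys \<Turnstile> \<psi>"
proof -
  from assms(3) have "mset ys = mset xs" by simp
  then obtain p where p: "p permutes {..<length xs}" "permute_list p xs = ys"
    by (rule mset_eq_permutation)
  then show ?thesis
    using assms(1,2) by (auto simp: commutative_constraint_def tuples_def)
qed

section \<open>Ordered products of lists in a monoid\<close>

lemma (in monoid) foldr_mult_closed:
  "set xs \<subseteq> carrier G \<Longrightarrow> foldr (\<otimes>) xs \<one> \<in> carrier G"
  by (induction xs) auto

lemma (in monoid) foldr_mult_append:
  "set xs \<subseteq> carrier G \<Longrightarrow> set ys \<subseteq> carrier G \<Longrightarrow>
     foldr (\<otimes>) (xs @ ys) \<one> = foldr (\<otimes>) xs \<one> \<otimes> foldr (\<otimes>) ys \<one>"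
  by (induction xs) (auto simp: m_assoc foldr_mult_closed)

lemma (in monoid) foldr_mult_replicate_one: "foldr (\<otimes>) (replicate n \<one>) \<one> = \<one>"
  by (induction n) (auto simp del: foldr_replicate)

section \<open>The group of a symmetric quasigroup with an exchange property\<close>

text \<open>The arity is written \<open>m + 2\<close>, so that \<open>k = m + 3\<close>.\<close>

locale exchange_quasigroup =
  fixes \<Omega> :: "'a set" and m :: nat and f :: "'a list \<Rightarrow> 'a" and z :: 'a
  assumes z: "z \<in> \<Omega>"
    and f_closed: "\<sigma> \<in> tuples \<Omega> (Suc (Suc m)) \<Longrightarrow> f \<sigma> \<in> \<Omega>"
    and f_mset: "\<sigma> \<in> tuples \<Omega> (Suc (Suc m)) \<Longrightarrow> mset \<sigma> = mset \<tau> \<Longrightarrow> f \<sigma> = f \<tau>"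
    and f_f: "x \<in> \<Omega> \<Longrightarrow> ys \<in> tuples \<Omega> (Suc m) \<Longrightarrow> f (f (x # ys) # ys) = x"
    and f_exchange: "\<sigma> \<in> tuples \<Omega> (Suc (Suc m)) \<Longrightarrow> \<tau> \<in> tuples \<Omega> (Suc (Suc m)) \<Longrightarrow>
      \<sigma>' \<in> tuples \<Omega> (Suc (Suc m)) \<Longrightarrow> \<tau>' \<in> tuples \<Omega> (Suc (Suc m)) \<Longrightarrow>
      mset \<sigma> + mset \<tau> = mset \<sigma>' + mset \<tau>' \<Longrightarrow>
      f (f \<sigma> # f \<tau> # replicate m (f (replicate (Suc (Suc m)) z)))
        = f (f \<sigma>' # f \<tau>' # replicate m (f (replicate (Suc (Suc m)) z)))"
begin

abbreviation S :: "'a \<Rightarrow> 'a" where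
  "S x \<equiv> f (x # z # replicate m z)"

abbreviation c :: 'a where
  "c \<equiv> f (z # z # replicate m z)"

text \<open>Since \<open>c\<close> is the value of \<open>f\<close> at the constant tuple
  \<open>z\<close>, this is the \<open>F2\<close> function built from a single constraint, taken at
  blocks \<sigma>, \<tau> and \<open>m\<close> blocks filled with \<open>z\<close>.\<close>

definition H :: "'a list \<Rightarrow> 'a list \<Rightarrow> 'a" where
  "H \<sigma> \<tau> = f (f \<sigma> # f \<tau> # replicate m c)"

text \<open>If \<open>f\<close> is to be \<open>c\<close> minus the sum of its arguments, with
  \<open>z\<close> neutral, then \<open>S x\<close> is \<open>c - x\<close>, and applying
  \<open>S\<close> to \<open>f (x # y # replicate m z)\<close> must return the sum of
  \<open>x\<close> and \<open>y\<close>. This forces the formula.\<close>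

definition sum_group :: "'a monoid" where
  "sum_group = \<lparr>carrier = \<Omega>, monoid.mult = (\<lambda>x y. S (f (x # y # replicate m z))), one = z\<rparr>"

lemma carrier_sum_group [simp]: "carrier sum_group = \<Omega>"
  and one_sum_group [simp]: "\<one>\<^bsub>sum_group\<^esub> = z"
  by (simp_all add: sum_group_def)

abbreviation add (infixl "\<oplus>" 65) where
  "x \<oplus> y \<equiv> x \<otimes>\<^bsub>sum_group\<^esub> y"

lemma add_def: "x \<oplus> y = S (f (x # y # replicate m z))"
  by (simp add: sum_group_def)

lemma S_closed [simp]: "x \<in> \<Omega> \<Longrightarrow> S x \<in> \<Omega>"
  using z by (simp add: f_closed)

lemma add_closed [simp]: "x \<in> \<Omega> \<Longrightarrow> y \<in> \<Omega> \<Longrightarrow> x \<oplus> y \<in> \<Omega>"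
  using z by (simp add: add_def f_closed)

lemma S_S [simp]: "x \<in> \<Omega> \<Longrightarrow> S (S x) = x"
  using z by (simp add: f_f)

lemma S_add: "x \<in> \<Omega> \<Longrightarrow> y \<in> \<Omega> \<Longrightarrow> S (x \<oplus> y) = f (x # y # replicate m z)"
  using z by (simp add: add_def f_closed)

text \<open>For fixed \<open>ys\<close>, the map sending \<open>x\<close> to
  \<open>f (x # ys)\<close> is its own inverse by \<open>f_f\<close>.\<close>

lemma f_inj:
  "f (x # ys) = f (x' # ys) \<Longrightarrow> x \<in> \<Omega> \<Longrightarrow> x' \<in> \<Omega> \<Longrightarrow> ys \<in> tuples \<Omega> (Suc m) \<Longrightarrow> x = x'"
  using f_f by metis

lemma H_exchange:
  assumes "\<sigma> \<in> tuples \<Omega> (Suc (Suc m))" "\<tau> \<in> tuples \<Omega> (Suc (Suc m))"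
    "\<sigma>' \<in> tuples \<Omega> (Suc (Suc m))" "\<tau>' \<in> tuples \<Omega> (Suc (Suc m))"
    "mset \<sigma> + mset \<tau> = mset \<sigma>' + mset \<tau>'"
  shows "H \<sigma> \<tau> = H \<sigma>' \<tau>'"
  using f_exchange[OF assms] by (simp add: H_def)

text \<open>The outer \<open>f\<close> is injective in its first argument, so a common second block
  cancels.\<close>

lemma H_inj:
  assumes "H \<sigma> \<tau> = H \<sigma>' \<tau>" "\<sigma> \<in> tuples \<Omega> (Suc (Suc m))" "\<sigma>' \<in> tuples \<Omega> (Suc (Suc m))"
    "\<tau> \<in> tuples \<Omega> (Suc (Suc m))"
  shows "f \<sigma> = f \<sigma>'"
proof (rule f_inj)
  show "f (f \<sigma> # f \<tau> # replicate m c) = f (f \<sigma>' # f \<tau> # replicate m c)"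
    using assms(1) by (simp add: H_def)
qed (use assms z in \<open>simp_all add: f_closed\<close>)

text \<open>Trading \<open>zs\<close> for entries \<open>z\<close> of the second block leaves
  \<open>x\<close> and \<open>y\<close> alone with padding in the first, where \<open>S_add\<close>
  replaces them by \<open>x \<oplus> y\<close> and \<open>z\<close>. A second exchange brings
  \<open>zs\<close> back, and \<open>H_inj\<close> drops the second block.\<close>

lemma f_merge:
  assumes "x \<in> \<Omega>" "y \<in> \<Omega>" "zs \<in> tuples \<Omega> m"
  shows "f (x # y # zs) = f ((x \<oplus> y) # z # zs)"
proof -
  let ?Z = "replicate m z"
  have "H (x # y # zs) (z # z # ?Z) = H (x # y # ?Z) (z # z # zs)"
    using assms z by (intro H_exchange) auto
  also have "\<dots> = H ((x \<oplus> y) # z # ?Z) (z # z # zs)"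
    using assms by (simp add: H_def S_add)
  also have "\<dots> = H ((x \<oplus> y) # z # zs) (z # z # ?Z)"
    using assms z by (intro H_exchange) auto
  finally show ?thesis
    by (rule H_inj) (use assms z in simp_all)
qed

lemma add_commute: "x \<in> \<Omega> \<Longrightarrow> y \<in> \<Omega> \<Longrightarrow> x \<oplus> y = y \<oplus> x"
  using z f_mset[of "x # y # replicate m z" "y # x # replicate m z"] by (simp add: add_def)

text \<open>Moving \<open>w\<close> to the second block and splitting \<open>x \<oplus> y\<close>
  leaves \<open>x\<close>, \<open>y\<close>, \<open>w\<close> as separate entries of two blocks, and
  these can be exchanged freely. Together with commutativity the rotation yields
  associativity.\<close>

lemma add_rotate:
  assumes "x \<in> \<Omega>" "y \<in> \<Omega>" "w \<in> \<Omega>"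
  shows "(x \<oplus> y) \<oplus> w = (y \<oplus> w) \<oplus> x"
proof -
  let ?Z = "replicate m z"
  have *: "H ((x \<oplus> y) # w # ?Z) (z # z # ?Z) = H (x # y # ?Z) (w # z # ?Z)"
    if "x \<in> \<Omega>" "y \<in> \<Omega>" "w \<in> \<Omega>" for x y w
  proof -
    have "H ((x \<oplus> y) # w # ?Z) (z # z # ?Z) = H ((x \<oplus> y) # z # ?Z) (w # z # ?Z)"
      using that z by (intro H_exchange) auto
    also have "\<dots> = H (x # y # ?Z) (w # z # ?Z)"
      using that by (simp add: H_def S_add)
    finally show ?thesis .
  qed
  have "H (x # y # ?Z) (w # z # ?Z) = H (y # w # ?Z) (x # z # ?Z)"
    using assms z by (intro H_exchange) auto
  then have "H ((x \<oplus> y) # w # ?Z) (z # z # ?Z) = H ((y \<oplus> w) # x # ?Z) (z # z # ?Z)"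
    using assms by (simp only: *)
  then have "f ((x \<oplus> y) # w # ?Z) = f ((y \<oplus> w) # x # ?Z)"
    by (rule H_inj) (use assms z in simp_all)
  then show ?thesis
    unfolding add_def[of "x \<oplus> y"] add_def[of "y \<oplus> w"] by simp
qed

lemma comm_group_sum_group: "comm_group sum_group"
proof (rule comm_groupI; simp)
  show "z \<in> \<Omega>" by (rule z)
  show "x \<oplus> y \<oplus> w = x \<oplus> (y \<oplus> w)" if "x \<in> \<Omega>" "y \<in> \<Omega>" "w \<in> \<Omega>" for x y w
    using that add_rotate[of x y w] add_commute[of x "y \<oplus> w"] by simp
  show "x \<oplus> y = y \<oplus> x" if "x \<in> \<Omega>" "y \<in> \<Omega>" for x y
    using that by (rule add_commute)
  show "z \<oplus> x = x" if "x \<in> \<Omega>" for x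
    using that z by (simp add: add_commute[of z x] add_def[of x z])
  show "\<exists>y\<in>\<Omega>. y \<oplus> x = z" if x: "x \<in> \<Omega>" for x
  proof
    \<comment> \<open>By \<open>f_f\<close> this solves
      \<open>f (y # x # replicate m z) = c\<close>. As \<open>c\<close> is \<open>S z\<close>,
      applying \<open>S\<close> to both sides gives \<open>y \<oplus> x = z\<close>.\<close>
    let ?y = "f (c # x # replicate m z)"
    show "?y \<in> \<Omega>" using x z by (simp add: f_closed)
    have "f (?y # x # replicate m z) = c"
      using x z by (simp add: f_f)
    then show "?y \<oplus> x = z"
      using z by (simp add: add_def)
  qed
qed

text \<open>Padding with \<open>z\<close> lets the number of summands vary at fixed arity:
  \<open>f_merge\<close> combines the first two entries, and the \<open>z\<close> it leaves behind
  joins the padding, so \<open>xs\<close> gets shorter by one. The case \<open>j = 0\<close> covers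
  full tuples.\<close>

lemma f_padded:
  assumes "set xs \<subseteq> \<Omega>" "length xs + j = Suc (Suc m)"
  shows "f (xs @ replicate j z) = S (foldr (\<oplus>) xs z)"
  using assms
proof (induction "length xs" arbitrary: xs j rule: less_induct)
  case less
  interpret comm_group sum_group by (rule comm_group_sum_group)
  show ?case
  proof (cases xs)
    case Nil
    then show ?thesis using less.prems by auto
  next
    case (Cons x ys)
    note xs = this
    show ?thesis
    proof (cases ys)
      case Nil
      then show ?thesis using xs less.prems r_one by auto
    next
      case (Cons y zs)
      have in\<Omega>: "x \<in> \<Omega>" "y \<in> \<Omega>" "set zs \<subseteq> \<Omega>" using less.prems xs Cons by auto
      have tup: "zs @ replicate j z \<in> tuples \<Omega> m"
        using less.prems xs Cons z by (auto simp: tuples_def)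
      have "f (xs @ replicate j z) = f ((x \<oplus> y) # z # (zs @ replicate j z))"
        using in\<Omega> tup by (simp add: xs Cons f_merge)
      also have "\<dots> = f (((x \<oplus> y) # zs) @ replicate (Suc j) z)"
        using in\<Omega> tup z by (intro f_mset) auto
      also have "\<dots> = S (foldr (\<oplus>) ((x \<oplus> y) # zs) z)"
        using less.prems in\<Omega> xs Cons by (intro less.hyps) auto
      also have "foldr (\<oplus>) ((x \<oplus> y) # zs) z = foldr (\<oplus>) xs z"
        using in\<Omega> foldr_mult_closed[of zs] by (simp add: xs Cons m_assoc)
      finally show ?thesis .
    qed
  qed
qed

text \<open>With \<open>u\<close> the sum of \<sigma>, \<open>f \<sigma>\<close> equals
  \<open>S u\<close>, that is, \<open>f (z # u # replicate m z)\<close>. Exchanging output and first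
  input by \<open>f_f\<close> recovers \<open>z\<close>, and \<open>S z\<close> is
  \<open>c\<close>.\<close>

lemma f_add_sum:
  assumes "\<sigma> \<in> tuples \<Omega> (Suc (Suc m))"
  shows "f \<sigma> \<oplus> foldr (\<oplus>) \<sigma> z = c"
proof -
  interpret comm_group sum_group by (rule comm_group_sum_group)
  define u where "u = foldr (\<oplus>) \<sigma> z"
  have u: "u \<in> \<Omega>"
    using assms foldr_mult_closed[of \<sigma>] by (simp add: u_def tuples_def)
  have "f \<sigma> = S u"
    using assms f_padded[of \<sigma> 0] by (simp add: u_def tuples_def)
  moreover have "S u = f (z # u # replicate m z)"
    using u z by (intro f_mset) auto
  moreover have "f (f (z # u # replicate m z) # u # replicate m z) = z"
    using u z by (simp add: f_f)
  ultimately have "S (f (f \<sigma> # u # replicate m z)) = c"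
    by simp
  then show ?thesis
    unfolding add_def[of "f \<sigma>"] u_def .
qed

end

section \<open>Uniquely extendable constraints\<close>

lemma ext_fun_props:
  assumes "\<psi> \<in> UE (Suc n) \<Omega>" "\<sigma> \<in> tuples \<Omega> n"
  shows ext_fun_closed: "ext_fun \<Omega> \<psi> \<sigma> \<in> \<Omega>"
    and ext_fun_models: "\<sigma> @ [ext_fun \<Omega> \<psi> \<sigma>] \<Turnstile> \<psi>"
    and ext_fun_eqI: "x \<in> \<Omega> \<Longrightarrow> \<sigma> @ [x] \<Turnstile> \<psi> \<Longrightarrow> ext_fun \<Omega> \<psi> \<sigma> = x"
proof -
  \<comment> \<open>Unique extendability at the last coordinate, which has index \<open>n\<close>
    and nothing to its right.\<close>
  have "\<exists>!x. x \<in> \<Omega> \<and> \<sigma> @ [x] @ [] \<Turnstile> \<psi>"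
    using assms unfolding UE_def uniquely_extendable_def by fastforce
  then have ex: "\<exists>!x. x \<in> \<Omega> \<and> \<sigma> @ [x] \<Turnstile> \<psi>" by simp
  from theI'[OF ex] show "ext_fun \<Omega> \<psi> \<sigma> \<in> \<Omega>" "\<sigma> @ [ext_fun \<Omega> \<psi> \<sigma>] \<Turnstile> \<psi>"
    by (simp_all add: ext_fun_def)
  show "ext_fun \<Omega> \<psi> \<sigma> = x" if "x \<in> \<Omega>" "\<sigma> @ [x] \<Turnstile> \<psi>"
    unfolding ext_fun_def using ex that by (blast intro: the1_equality)
qed

text \<open>A rearrangement of the first \<open>n\<close> coordinates that keeps the last one
  preserves \<psi>, so the same spin completes both tuples.\<close>

lemma ext_fun_mset:
  assumes "\<psi> \<in> UE (Suc n) \<Omega>" "commutative_constraint (Suc n) \<Omega> \<psi>"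
    "\<sigma> \<in> tuples \<Omega> n" "mset \<sigma> = mset \<tau>"
  shows "ext_fun \<Omega> \<psi> \<sigma> = ext_fun \<Omega> \<psi> \<tau>"
proof -
  have "set \<tau> = set \<sigma>" "length \<tau> = length \<sigma>"
    using mset_eq_setD[OF assms(4)] mset_eq_length[OF assms(4)] by simp_all
  then have \<tau>: "\<tau> \<in> tuples \<Omega> n"
    using assms(3) by (simp add: tuples_def)
  let ?x = "ext_fun \<Omega> \<psi> \<tau>"
  have x: "?x \<in> \<Omega>" "\<tau> @ [?x] \<Turnstile> \<psi>"
    by (rule ext_fun_closed[OF assms(1) \<tau>], rule ext_fun_models[OF assms(1) \<tau>])
  have "\<tau> @ [?x] \<in> tuples \<Omega> (Suc n)"
    using append_in_tuples[OF \<tau>, of "[?x]" 1] x by simp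
  moreover have "mset (\<tau> @ [?x]) = mset (\<sigma> @ [?x])"
    using assms(4) by simp
  ultimately have "\<sigma> @ [?x] \<Turnstile> \<psi>"
    using commutative_constraint_mset[OF assms(2)] x(2) by blast
  then show ?thesis
    by (rule ext_fun_eqI[OF assms(1,3) x(1)])
qed

text \<open>Swapping the first and last entries of the satisfying tuple exchanges \<open>x\<close>
  with the output and again satisfies \<psi>.\<close>

lemma ext_fun_ext_fun:
  assumes "\<psi> \<in> UE (Suc (Suc n)) \<Omega>" "commutative_constraint (Suc (Suc n)) \<Omega> \<psi>"
    "x \<in> \<Omega>" "ys \<in> tuples \<Omega> n"
  shows "ext_fun \<Omega> \<psi> (ext_fun \<Omega> \<psi> (x # ys) # ys) = x"
proof -
  let ?w = "ext_fun \<Omega> \<psi> (x # ys)"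
  have xs: "x # ys \<in> tuples \<Omega> (Suc n)" using assms by simp
  have w: "?w \<in> \<Omega>" "(x # ys) @ [?w] \<Turnstile> \<psi>"
    by (rule ext_fun_closed[OF assms(1) xs], rule ext_fun_models[OF assms(1) xs])
  have "(x # ys) @ [?w] \<in> tuples \<Omega> (Suc (Suc n))"
    using append_in_tuples[OF xs, of "[?w]" 1] w by simp
  then have "(?w # ys) @ [x] \<Turnstile> \<psi>"
    using commutative_constraint_mset[OF assms(2), of "(x # ys) @ [?w]" "(?w # ys) @ [x]"] w by simp
  moreover have "?w # ys \<in> tuples \<Omega> (Suc n)" using w assms by simp
  ultimately show ?thesis
    using ext_fun_eqI[OF assms(1) _ assms(3)] by simp
qed

section \<open>Realizing and exploiting functions in \<open>F2\<close>\<close>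

text \<open>Membership in \<open>F2\<close> prescribes values only on concatenations of blocks.
  Every choice of constraints is realized by decomposing the flat argument with the inverse of
  \<open>concat\<close>, which makes the symmetry hypothesis applicable to that choice.\<close>

lemma F2_exists:
  assumes "\<Psi> \<subseteq> UE (Suc n) \<Omega>" "\<psi>0 \<in> \<Psi>" "\<psi>s \<in> tuples \<Psi> n"
  obtains F where "F \<in> F2 (Suc n) \<Omega> \<Psi>"
    and "\<And>\<sigma>s. \<sigma>s \<in> tuples (tuples \<Omega> n) n \<Longrightarrow>
           F (concat \<sigma>s) = ext_fun \<Omega> \<psi>0 (map2 (ext_fun \<Omega>) \<psi>s \<sigma>s)"
proof
  define g where "g \<sigma>s = ext_fun \<Omega> \<psi>0 (map2 (ext_fun \<Omega>) \<psi>s \<sigma>s)" for \<sigma>s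
  define B where "B = tuples (tuples \<Omega> n) n"
  define F where "F = (\<lambda>xs\<in>tuples \<Omega> (n * n). g (inv_into B concat xs))"
  have g: "g \<sigma>s \<in> \<Omega>" if "\<sigma>s \<in> B" for \<sigma>s
  proof -
    have "ext_fun \<Omega> \<psi> \<sigma> \<in> \<Omega>" if "(\<psi>, \<sigma>) \<in> set (zip \<psi>s \<sigma>s)" for \<psi> \<sigma>
    proof (rule ext_fun_closed)
      show "\<psi> \<in> UE (Suc n) \<Omega>"
        using set_zip_leftD[OF that] assms by (auto simp: tuples_def)
      show "\<sigma> \<in> tuples \<Omega> n"
        using set_zip_rightD[OF that] \<open>\<sigma>s \<in> B\<close> unfolding B_def by (auto simp: tuples_def)
    qed
    then have "map2 (ext_fun \<Omega>) \<psi>s \<sigma>s \<in> tuples \<Omega> n"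
      using that assms(3) unfolding B_def by (auto simp: tuples_def)
    then show ?thesis
      unfolding g_def by (intro ext_fun_closed[OF subsetD[OF assms(1,2)]])
  qed
  show *: "F (concat \<sigma>s) = ext_fun \<Omega> \<psi>0 (map2 (ext_fun \<Omega>) \<psi>s \<sigma>s)"
    if "\<sigma>s \<in> tuples (tuples \<Omega> n) n" for \<sigma>s
    using that concat_in_tuples[OF that] inv_into_f_f[OF inj_on_concat_tuples that]
    by (simp add: F_def B_def flip: g_def)
  have "F \<in> tuples \<Omega> (n * n) \<rightarrow>\<^sub>E \<Omega>"
  proof
    show "F xs \<in> \<Omega>" if xs: "xs \<in> tuples \<Omega> (n * n)" for xs
    proof -
      have "xs \<in> concat ` B" using xs unfolding B_def by (simp add: tuples_eq_concat_image)
      then have "inv_into B concat xs \<in> B" by (rule inv_into_into)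
      then show ?thesis using xs g by (simp add: F_def)
    qed
  qed (simp add: F_def)
  then show "F \<in> F2 (Suc n) \<Omega> \<Psi>"
    unfolding F2_def using assms(2,3) * by (auto simp: power2_eq_square)
qed

text \<open>Symmetry is applied to the \<open>F2\<close> function with \<phi> on the first block and
  \<psi> everywhere else; all blocks after the second are \<rho>, so both flat tuples have the same
  multiset. For \<phi> equal to \<psi> this is the exchange law of the quasigroup; for other \<phi>
  it compares the two constraints.\<close>

lemma ext_fun_exchange:
  assumes UE: "\<Psi> \<subseteq> UE (Suc (Suc (Suc m))) \<Omega>"
    and sym: "\<forall>F\<in>F2 (Suc (Suc (Suc m))) \<Omega> \<Psi>. symmetric_fun ((Suc (Suc m))\<^sup>2) \<Omega> F"
    and \<psi>: "\<psi> \<in> \<Psi>" and \<phi>: "\<phi> \<in> \<Psi>" and \<rho>: "\<rho> \<in> tuples \<Omega> (Suc (Suc m))"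
    and \<sigma>\<tau>: "\<sigma> \<in> tuples \<Omega> (Suc (Suc m))" "\<tau> \<in> tuples \<Omega> (Suc (Suc m))"
    and \<sigma>\<tau>': "\<sigma>' \<in> tuples \<Omega> (Suc (Suc m))" "\<tau>' \<in> tuples \<Omega> (Suc (Suc m))"
    and mset: "mset \<sigma> + mset \<tau> = mset \<sigma>' + mset \<tau>'"
  defines "f \<equiv> ext_fun \<Omega> \<psi>" and "g \<equiv> ext_fun \<Omega> \<phi>"
  shows "f (g \<sigma> # f \<tau> # replicate m (f \<rho>)) = f (g \<sigma>' # f \<tau>' # replicate m (f \<rho>))"
proof -
  let ?n = "Suc (Suc m)"
  have "\<phi> # \<psi> # replicate m \<psi> \<in> tuples \<Psi> ?n" using \<psi> \<phi> by simp
  from F2_exists[OF UE \<psi> this] obtain F where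
    F: "F \<in> F2 (Suc ?n) \<Omega> \<Psi>"
    and eq: "\<And>\<sigma>s. \<sigma>s \<in> tuples (tuples \<Omega> ?n) ?n \<Longrightarrow>
        F (concat \<sigma>s) = ext_fun \<Omega> \<psi> (map2 (ext_fun \<Omega>) (\<phi> # \<psi> # replicate m \<psi>) \<sigma>s)"
    by blast
  have val: "F (concat (\<sigma> # \<tau> # replicate m \<rho>)) = f (g \<sigma> # f \<tau> # replicate m (f \<rho>))"
    if "\<sigma> \<in> tuples \<Omega> ?n" "\<tau> \<in> tuples \<Omega> ?n" for \<sigma> \<tau>
  proof -
    have "\<sigma> # \<tau> # replicate m \<rho> \<in> tuples (tuples \<Omega> ?n) ?n" using that \<rho> by simp
    from eq[OF this] show ?thesis
      by (simp add: f_def g_def zip_replicate map_replicate)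
  qed
  have "concat (\<sigma> # \<tau> # replicate m \<rho>) \<in> tuples \<Omega> (?n * ?n)"
    by (rule concat_in_tuples) (use \<rho> \<sigma>\<tau> in simp)
  moreover have "mset (concat (\<sigma> # \<tau> # replicate m \<rho>)) = mset (concat (\<sigma>' # \<tau>' # replicate m \<rho>))"
    using mset by (simp flip: union_assoc)
  ultimately have "F (concat (\<sigma> # \<tau> # replicate m \<rho>)) = F (concat (\<sigma>' # \<tau>' # replicate m \<rho>))"
    by (rule symmetric_funD_mset[OF bspec[OF sym F, unfolded power2_eq_square]])
  then show ?thesis using val[OF \<sigma>\<tau>] val[OF \<sigma>\<tau>'] by simp
qed

section \<open>Constraints given by groups\<close>

lemma group_constraint_models:
  assumes "\<sigma> \<in> tuples (carrier G) k"
  shows "\<sigma> \<Turnstile> group_constraint k G b \<longleftrightarrow> foldr (\<otimes>\<^bsub>G\<^esub>) \<sigma> \<one>\<^bsub>G\<^esub> = b"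
  using assms by (simp add: models_def group_constraint_def)

text \<open>A third coordinate \<open>w\<close> completes arbitrary \<open>x\<close>,
  \<open>y\<close> to a tuple with product \<open>b\<close>, the rest being \<one>. Swapping
  \<open>x\<close> and \<open>y\<close> keeps the product, and \<open>w\<close> cancels.\<close>

lemma (in group) comm_group_if_commutative_constraint:
  assumes "b \<in> carrier G"
    and "commutative_constraint (Suc (Suc (Suc m))) (carrier G)
           (group_constraint (Suc (Suc (Suc m))) G b)"
  shows "comm_group G"
proof (rule group_comm_groupI)
  fix x y assume xy: "x \<in> carrier G" "y \<in> carrier G"
  define w where "w = inv (x \<otimes> y) \<otimes> b"
  have w: "w \<in> carrier G" using xy assms by (simp add: w_def)
  let ?xs = "x # y # w # replicate m \<one>" and ?ys = "y # x # w # replicate m \<one>"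
  have tup: "?xs \<in> tuples (carrier G) (Suc (Suc (Suc m)))" "?ys \<in> tuples (carrier G) (Suc (Suc (Suc m)))"
    using xy w by simp_all
  have prod: "x \<otimes> y \<otimes> w = b"
    using xy assms(1) by (simp add: w_def flip: m_assoc)
  have "?xs \<Turnstile> group_constraint (Suc (Suc (Suc m))) G b"
    using prod xy w tup by (simp add: group_constraint_models foldr_mult_replicate_one m_assoc del: foldr_replicate)
  then have "?ys \<Turnstile> group_constraint (Suc (Suc (Suc m))) G b"
    using commutative_constraint_mset[OF assms(2) tup(1), of ?ys] by simp
  then have "y \<otimes> x \<otimes> w = b"
    using xy w tup by (simp add: group_constraint_models foldr_mult_replicate_one m_assoc del: foldr_replicate)
  with prod have "x \<otimes> y \<otimes> w = y \<otimes> x \<otimes> w" by simp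
  then show "x \<otimes> y = y \<otimes> x"
    using xy w by (simp add: right_cancel)
qed

text \<open>Written as a product without inverses, so that such equations can be multiplied over
  several blocks.\<close>

lemma (in comm_group) ext_fun_group_constraint:
  assumes "group_constraint (Suc n) G b \<in> UE (Suc n) (carrier G)" "\<sigma> \<in> tuples (carrier G) n"
  shows "ext_fun (carrier G) (group_constraint (Suc n) G b) \<sigma> \<otimes> foldr (\<otimes>) \<sigma> \<one> = b"
proof -
  let ?x = "ext_fun (carrier G) (group_constraint (Suc n) G b) \<sigma>"
  have x: "?x \<in> carrier G" by (rule ext_fun_closed[OF assms])
  have "\<sigma> @ [?x] \<in> tuples (carrier G) (Suc n)"
    using append_in_tuples[OF assms(2), of "[?x]" 1] x by simp
  then have "foldr (\<otimes>) (\<sigma> @ [?x]) \<one> = b"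
    using ext_fun_models[OF assms] by (simp only: group_constraint_models)
  moreover have "set \<sigma> \<subseteq> carrier G" using assms(2) by (simp add: tuples_def)
  ultimately show ?thesis
    using x by (simp add: foldr_mult_append foldr_mult_closed m_comm del: foldr_append)
qed

text \<open>Additively, \<open>F \<sigma>\<close> is \<open>b \<psi>0\<close> minus the sum of the
  inner constants plus the sum of all entries of \<sigma>: the two subtractions cancel, and the sum
  of all entries ignores their order.\<close>

lemma (in comm_group) F2_group_symmetric:
  assumes UE: "\<Psi> \<subseteq> UE (Suc n) (carrier G)"
    and b: "b \<in> \<Psi> \<rightarrow> carrier G"
    and eq: "\<forall>\<psi>\<in>\<Psi>. \<psi> = group_constraint (Suc n) G (b \<psi>)"
    and F: "F \<in> F2 (Suc n) (carrier G) \<Psi>"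
  shows "symmetric_fun (n\<^sup>2) (carrier G) F"
proof -
  let ?e = "ext_fun (carrier G)" and ?P = "\<lambda>xs. foldr (\<otimes>) xs \<one>"
  from F obtain \<psi>0 \<psi>s where F\<Omega>: "\<And>\<sigma>. \<sigma> \<in> tuples (carrier G) (n * n) \<Longrightarrow> F \<sigma> \<in> carrier G"
    and \<psi>0: "\<psi>0 \<in> \<Psi>" and \<psi>s: "\<psi>s \<in> tuples \<Psi> n"
    and Feq: "\<And>\<sigma>s. \<sigma>s \<in> tuples (tuples (carrier G) n) n \<Longrightarrow>
                F (concat \<sigma>s) = ?e \<psi>0 (map2 ?e \<psi>s \<sigma>s)"
    unfolding F2_def by (auto simp: power2_eq_square)
  have e: "?e \<psi> \<sigma> \<in> carrier G" "?e \<psi> \<sigma> \<otimes> ?P \<sigma> = b \<psi>"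
    if "\<psi> \<in> \<Psi>" "\<sigma> \<in> tuples (carrier G) n" for \<psi> \<sigma>
    using that UE eq ext_fun_closed[of \<psi> n "carrier G" \<sigma>] ext_fun_group_constraint[of n "b \<psi>" \<sigma>]
    by auto
  \<comment> \<open>The block equations multiplied together. The lists have arbitrary equal length
    so that the induction goes through.\<close>
  have inner: "set (map2 ?e \<psi>s \<sigma>s) \<subseteq> carrier G \<and>
      ?P (map2 ?e \<psi>s \<sigma>s) \<otimes> ?P (concat \<sigma>s) = ?P (map b \<psi>s)"
    if "length \<psi>s = length \<sigma>s" "set \<psi>s \<subseteq> \<Psi>" "set \<sigma>s \<subseteq> tuples (carrier G) n" for \<psi>s \<sigma>s
    using that
  proof (induction \<psi>s \<sigma>s rule: list_induct2)
    case Nil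
    then show ?case by simp
  next
    case (Cons \<psi> \<psi>s \<sigma> \<sigma>s)
    have IH: "set (map2 ?e \<psi>s \<sigma>s) \<subseteq> carrier G"
        "?P (map2 ?e \<psi>s \<sigma>s) \<otimes> ?P (concat \<sigma>s) = ?P (map b \<psi>s)"
      using Cons by simp_all
    have s: "set \<sigma> \<subseteq> carrier G" "set (concat \<sigma>s) \<subseteq> carrier G"
      using Cons.prems by (auto simp: tuples_def)
    have c: "?e \<psi> \<sigma> \<in> carrier G" "?P \<sigma> \<in> carrier G" "?P (concat \<sigma>s) \<in> carrier G"
        "?P (map2 ?e \<psi>s \<sigma>s) \<in> carrier G" "?e \<psi> \<sigma> \<otimes> ?P \<sigma> = b \<psi>"
      using e Cons.prems IH s foldr_mult_closed by simp_all
    have "?P (map2 ?e (\<psi> # \<psi>s) (\<sigma> # \<sigma>s)) \<otimes> ?P (concat (\<sigma> # \<sigma>s))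
        = (?e \<psi> \<sigma> \<otimes> ?P (map2 ?e \<psi>s \<sigma>s)) \<otimes> (?P \<sigma> \<otimes> ?P (concat \<sigma>s))"
      using foldr_mult_append[OF s] by simp
    also have "\<dots> = (?e \<psi> \<sigma> \<otimes> ?P \<sigma>) \<otimes> (?P (map2 ?e \<psi>s \<sigma>s) \<otimes> ?P (concat \<sigma>s))"
      using c(1-4) by (simp add: m_ac)
    also have "\<dots> = ?P (map b (\<psi> # \<psi>s))"
      using c(5) IH(2) by simp
    finally show ?case using IH(1) c(1) by simp
  qed
  have key: "F \<sigma> \<otimes> ?P (map b \<psi>s) = b \<psi>0 \<otimes> ?P \<sigma>"
    if \<sigma>: "\<sigma> \<in> tuples (carrier G) (n * n)" for \<sigma>
  proof -
    obtain \<sigma>s where \<sigma>s: "\<sigma>s \<in> tuples (tuples (carrier G) n) n" "\<sigma> = concat \<sigma>s"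
      using \<sigma> unfolding tuples_eq_concat_image by blast
    let ?ys = "map2 ?e \<psi>s \<sigma>s"
    have ys: "set ?ys \<subseteq> carrier G" "?P ?ys \<otimes> ?P \<sigma> = ?P (map b \<psi>s)"
      using inner[of \<psi>s \<sigma>s] \<psi>s \<sigma>s by (auto simp: tuples_def)
    then have "?ys \<in> tuples (carrier G) n"
      using \<psi>s \<sigma>s by (auto simp: tuples_def)
    then have 1: "F \<sigma> \<otimes> ?P ?ys = b \<psi>0"
      using e(2)[OF \<psi>0] Feq[OF \<sigma>s(1)] \<sigma>s(2) by simp
    have "?P \<sigma> \<in> carrier G" "?P ?ys \<in> carrier G"
      using \<sigma> ys foldr_mult_closed by (simp_all add: tuples_def)
    \<comment> \<open>Replacing \<open>b \<psi>0\<close> and \<open>?P (map b \<psi>s)\<close> by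
      the products they equal turns both sides into the product of \<open>F \<sigma>\<close>,
      \<open>?P ?ys\<close> and \<open>?P \<sigma>\<close>.\<close>
    then show ?thesis
      using F\<Omega>[OF \<sigma>] by (simp flip: 1 ys(2) add: m_assoc)
  qed
  have Pb: "?P (map b \<psi>s) \<in> carrier G"
    using \<psi>s b by (intro foldr_mult_closed) (auto simp: tuples_def)
  show ?thesis
    unfolding symmetric_fun_def power2_eq_square
  proof (intro ballI allI impI)
    fix \<sigma> \<pi> assume \<sigma>: "\<sigma> \<in> tuples (carrier G) (n * n)" and \<pi>: "\<pi> permutes {..<n * n}"
    then have ms: "mset (permute_list \<pi> \<sigma>) = mset \<sigma>" by (simp add: tuples_def)
    then have \<sigma>': "permute_list \<pi> \<sigma> \<in> tuples (carrier G) (n * n)"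
      using \<sigma> mset_eq_setD[OF ms] by (simp add: tuples_def)
    have "?P (permute_list \<pi> \<sigma>) = ?P \<sigma>"
      using ms \<sigma>' by (intro multlist_perm_cong) (auto simp: tuples_def)
    then have "F (permute_list \<pi> \<sigma>) \<otimes> ?P (map b \<psi>s) = F \<sigma> \<otimes> ?P (map b \<psi>s)"
      using key[OF \<sigma>] key[OF \<sigma>'] by simp
    then show "F (permute_list \<pi> \<sigma>) = F \<sigma>"
      using Pb F\<Omega>[OF \<sigma>] F\<Omega>[OF \<sigma>'] by (simp add: right_cancel)
  qed
qed

section \<open>Recovering the constraints from a group, and the group from symmetry\<close>

text \<open>A tuple satisfies \<psi> exactly when its last entry is the extension of the others, so
  \<psi> is determined by its extension function: its values on tuples are 0 or 1, and elsewhere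
  both sides are \<open>undefined\<close>.\<close>

lemma (in comm_group) eq_group_constraintI:
  assumes UE: "\<psi> \<in> UE (Suc n) (carrier G)"
    and ext: "\<And>\<sigma>. \<sigma> \<in> tuples (carrier G) n \<Longrightarrow>
                ext_fun (carrier G) \<psi> \<sigma> \<otimes> foldr (\<otimes>) \<sigma> \<one> = b"
  shows "\<psi> = group_constraint (Suc n) G b"
proof
  fix xs
  show "\<psi> xs = group_constraint (Suc n) G b xs"
  proof (cases "xs \<in> tuples (carrier G) (Suc n)")
    case False
    then show ?thesis
      using UE by (auto simp: UE_def constraint_functions_def group_constraint_def)
  next
    case True
    then obtain \<sigma> x where xs: "xs = \<sigma> @ [x]"
      by (cases xs rule: rev_cases) (auto simp: tuples_def)
    with True have \<sigma>: "\<sigma> \<in> tuples (carrier G) n" and x: "x \<in> carrier G"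
      by (auto simp: tuples_def)
    then have P: "foldr (\<otimes>) \<sigma> \<one> \<in> carrier G"
      by (simp add: tuples_def foldr_mult_closed)
    have "xs \<Turnstile> \<psi> \<longleftrightarrow> ext_fun (carrier G) \<psi> \<sigma> = x"
      using ext_fun_models[OF UE \<sigma>] ext_fun_eqI[OF UE \<sigma> x] by (auto simp: xs)
    also have "\<dots> \<longleftrightarrow> x \<otimes> foldr (\<otimes>) \<sigma> \<one> = b"
      using ext[OF \<sigma>] P x ext_fun_closed[OF UE \<sigma>] by (auto simp: right_cancel)
    also have "x \<otimes> foldr (\<otimes>) \<sigma> \<one> = foldr (\<otimes>) xs \<one>"
      using \<sigma> x P foldr_mult_append[of \<sigma> "[x]"] by (simp add: xs tuples_def m_comm)
    finally have "\<psi> xs = 1 \<longleftrightarrow> foldr (\<otimes>) xs \<one> = b"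
      by (simp add: models_def)
    moreover have "\<psi> xs \<in> {0, 1}"
      using UE True by (auto simp: UE_def constraint_functions_def)
    ultimately show ?thesis
      using True by (auto simp: group_constraint_def)
  qed
qed

text \<open>The cyclic group of order \<open>card \<Omega>\<close> is transported along a bijection.
  This serves the case of empty \<Psi>, where a group on \<Omega> is still to be found.\<close>

lemma exists_group_on_finite:
  assumes "finite \<Omega>" "\<Omega> \<noteq> {}"
  shows "\<exists>G :: 'a monoid. group G \<and> carrier G = (\<Omega> :: 'a set)"
proof -
  have "card \<Omega> > 0" using assms by (simp add: card_gt_0_iff)
  then have carr: "carrier (integer_mod_group (card \<Omega>)) = {0..<int (card \<Omega>)}"
    by (simp add: carrier_integer_mod_group)
  obtain h where h: "bij_betw h {0..<int (card \<Omega>)} \<Omega>"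
    using finite_same_card_bij[of "{0..<int (card \<Omega>)}" \<Omega>] assms by auto
  interpret group "integer_mod_group (card \<Omega>)" by simp
  have "group (image_group h (integer_mod_group (card \<Omega>)))"
    using h by (intro inj_imp_image_group_is_group) (simp add: carr bij_betw_def)
  moreover have "carrier (image_group h (integer_mod_group (card \<Omega>))) = \<Omega>"
    using h by (simp add: image_group_carrier carr bij_betw_def)
  ultimately show ?thesis by blast
qed

text \<open>The group is built from \<psi> alone; the exchange law with another \<phi> on the first
  block then shows that the same group describes \<phi>.\<close>

lemma group_if_F2_symmetric:
  fixes \<Omega> :: "'a set"
  assumes UE: "\<Psi> \<subseteq> UE (Suc (Suc (Suc m))) \<Omega>"
    and comm: "\<And>\<psi>. \<psi> \<in> \<Psi> \<Longrightarrow> commutative_constraint (Suc (Suc (Suc m))) \<Omega> \<psi>"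
    and sym: "\<forall>F\<in>F2 (Suc (Suc (Suc m))) \<Omega> \<Psi>. symmetric_fun ((Suc (Suc m))\<^sup>2) \<Omega> F"
    and \<psi>: "\<psi> \<in> \<Psi>" and z: "z \<in> \<Omega>"
  shows "\<exists>(G :: 'a monoid) b. group G \<and> carrier G = \<Omega> \<and> b \<in> \<Psi> \<rightarrow> \<Omega> \<and>
           (\<forall>\<phi>\<in>\<Psi>. \<phi> = group_constraint (Suc (Suc (Suc m))) G (b \<phi>))"
proof -
  let ?n = "Suc (Suc m)"
  let ?f = "ext_fun \<Omega> \<psi>"
  have zs: "replicate ?n z \<in> tuples \<Omega> ?n" using z by (rule replicate_in_tuples)
  have \<psi>U: "\<psi> \<in> UE (Suc ?n) \<Omega>" using UE \<psi> by blast
  interpret Q: exchange_quasigroup \<Omega> m ?f z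
  proof
    show "z \<in> \<Omega>" by (rule z)
  next
    fix \<sigma> assume "\<sigma> \<in> tuples \<Omega> ?n"
    with \<psi>U show "?f \<sigma> \<in> \<Omega>" by (rule ext_fun_closed)
  next
    fix \<sigma> \<tau> assume "\<sigma> \<in> tuples \<Omega> ?n" "mset \<sigma> = mset \<tau>"
    with \<psi>U comm[OF \<psi>] show "?f \<sigma> = ?f \<tau>" by (rule ext_fun_mset)
  next
    fix x ys assume "x \<in> \<Omega>" "ys \<in> tuples \<Omega> (Suc m)"
    with \<psi>U comm[OF \<psi>] show "?f (?f (x # ys) # ys) = x" by (rule ext_fun_ext_fun)
  next
    fix \<sigma> \<tau> \<sigma>' \<tau>'
    assume "\<sigma> \<in> tuples \<Omega> ?n" "\<tau> \<in> tuples \<Omega> ?n" "\<sigma>' \<in> tuples \<Omega> ?n" "\<tau>' \<in> tuples \<Omega> ?n"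
      "mset \<sigma> + mset \<tau> = mset \<sigma>' + mset \<tau>'"
    then show "?f (?f \<sigma> # ?f \<tau> # replicate m (?f (replicate ?n z)))
        = ?f (?f \<sigma>' # ?f \<tau>' # replicate m (?f (replicate ?n z)))"
      by (rule ext_fun_exchange[OF UE sym \<psi> \<psi> zs])
  qed
  interpret G: comm_group Q.sum_group by (rule Q.comm_group_sum_group)
  let ?G = Q.sum_group
  let ?P = "\<lambda>xs. foldr (\<otimes>\<^bsub>?G\<^esub>) xs z"
  \<comment> \<open>The value is forced: \<open>z\<close> is neutral, so a constant tuple
    \<open>z\<close> contributes nothing to the sum.\<close>
  define b where "b \<phi> = ext_fun \<Omega> \<phi> (replicate ?n z)" for \<phi>
  have b: "b \<in> \<Psi> \<rightarrow> \<Omega>"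
    unfolding b_def by (intro funcsetI ext_fun_closed[OF subsetD[OF UE]] zs)
  have "\<phi> = group_constraint (Suc ?n) ?G (b \<phi>)" if \<phi>: "\<phi> \<in> \<Psi>" for \<phi>
  proof (rule G.eq_group_constraintI)
    show "\<phi> \<in> UE (Suc ?n) (carrier ?G)" using UE \<phi> by auto
    fix \<sigma> assume "\<sigma> \<in> tuples (carrier ?G) ?n"
    then have \<sigma>: "\<sigma> \<in> tuples \<Omega> ?n" by simp
    let ?u = "ext_fun \<Omega> \<phi> \<sigma>" and ?c = "?f (replicate ?n z)"
    have u: "?u \<in> \<Omega>" "b \<phi> \<in> \<Omega>" "?f \<sigma> \<in> \<Omega>" "?c \<in> \<Omega>" "?P \<sigma> \<in> \<Omega>"
      using subsetD[OF UE \<phi>] \<sigma> zs b \<phi> G.foldr_mult_closed[of \<sigma>]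
      by (auto simp: tuples_def Q.f_closed ext_fun_closed)
    \<comment> \<open>The entries of \<sigma> change places with the entries \<open>z\<close> of the
      second block.\<close>
    have "?f (?u # ?c # replicate m ?c) = ?f (b \<phi> # ?f \<sigma> # replicate m ?c)"
      unfolding b_def using \<sigma> zs by (intro ext_fun_exchange[OF UE sym \<psi> \<phi> zs]) auto
    \<comment> \<open>The value of \<open>?f\<close> determines the sum of its arguments, because by
      \<open>f_add_sum\<close> the two always add up to \<open>?c\<close>.\<close>
    moreover have "?P \<rho> = ?P \<rho>'"
      if "\<rho> \<in> tuples \<Omega> ?n" "\<rho>' \<in> tuples \<Omega> ?n" "?f \<rho> = ?f \<rho>'" for \<rho> \<rho>'
    proof -
      have "?f \<rho> \<otimes>\<^bsub>?G\<^esub> ?P \<rho> = ?f \<rho> \<otimes>\<^bsub>?G\<^esub> ?P \<rho>'"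
        using Q.f_add_sum[OF that(1)] Q.f_add_sum[OF that(2)] that(3) by simp
      moreover have "?f \<rho> \<in> \<Omega>" "?P \<rho> \<in> \<Omega>" "?P \<rho>' \<in> \<Omega>"
        using that Q.f_closed G.foldr_mult_closed[of \<rho>] G.foldr_mult_closed[of \<rho>']
        by (simp_all add: tuples_def)
      ultimately show ?thesis by simp
    qed
    moreover have "?u # ?c # replicate m ?c \<in> tuples \<Omega> ?n" "b \<phi> # ?f \<sigma> # replicate m ?c \<in> tuples \<Omega> ?n"
      using u by simp_all
    ultimately have "?P (?u # ?c # replicate m ?c) = ?P (b \<phi> # ?f \<sigma> # replicate m ?c)"
      by blast
    moreover have "?P (replicate m ?c) \<in> \<Omega>"
      using G.foldr_mult_closed[of "replicate m ?c"] u
      by (simp add: set_replicate_conv_if del: foldr_replicate)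
    \<comment> \<open>The common summand, \<open>m\<close> copies of \<open>?c\<close>,
      cancels.\<close>
    ultimately have "?u \<otimes>\<^bsub>?G\<^esub> ?c = b \<phi> \<otimes>\<^bsub>?G\<^esub> ?f \<sigma>"
      using u by (simp del: foldr_replicate flip: G.m_assoc)
    moreover have "?f \<sigma> \<otimes>\<^bsub>?G\<^esub> ?P \<sigma> = ?c"
      using Q.f_add_sum[OF \<sigma>] by simp
    \<comment> \<open>Writing \<open>?c\<close> as \<open>?f \<sigma>\<close> plus the sum of
      \<sigma> makes \<open>?f \<sigma>\<close> a common summand of both sides.\<close>
    ultimately have "(?u \<otimes>\<^bsub>?G\<^esub> ?P \<sigma>) \<otimes>\<^bsub>?G\<^esub> ?f \<sigma> = b \<phi> \<otimes>\<^bsub>?G\<^esub> ?f \<sigma>"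
      using u by (simp add: G.m_assoc G.m_comm[of "?P \<sigma>" "?f \<sigma>"])
    then have "?u \<otimes>\<^bsub>?G\<^esub> ?P \<sigma> = b \<phi>"
      using u by simp
    then show "ext_fun (carrier ?G) \<phi> \<sigma> \<otimes>\<^bsub>?G\<^esub> foldr (\<otimes>\<^bsub>?G\<^esub>) \<sigma> \<one>\<^bsub>?G\<^esub> = b \<phi>" by simp
  qed
  then show ?thesis
    using b by (intro exI[of _ ?G] exI[of _ b]) (auto simp: G.is_group)
qed

theorem theorem1p16:
  fixes \<Omega> :: "'a set" and r k :: nat and \<Psi> :: "'a constraint set"
  assumes "finite \<Omega>" and "card \<Omega> = r" and "r \<ge> 2"
    and "k \<ge> 3"
    and "\<Psi> \<subseteq> UE k \<Omega>"
    and "\<And>\<psi>. \<psi> \<in> \<Psi> \<Longrightarrow> commutative_constraint k \<Omega> \<psi>"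
  shows "(\<exists>(G :: 'a monoid) b. group G \<and> carrier G = \<Omega> \<and> b \<in> \<Psi> \<rightarrow> \<Omega> \<and>
            (\<forall>\<psi>\<in>\<Psi>. \<psi> = group_constraint k G (b \<psi>)))
         \<longleftrightarrow> (\<forall>F\<in>F2 k \<Omega> \<Psi>. symmetric_fun ((k - 1)\<^sup>2) \<Omega> F)"
    (is "?group \<longleftrightarrow> ?sym")
proof -
  obtain m where k: "k = Suc (Suc (Suc m))"
    using \<open>k \<ge> 3\<close> by (metis Suc_le_D numeral_3_eq_3 Suc_le_mono)
  have "\<Omega> \<noteq> {}" using assms(2,3) by auto
  show ?thesis
  proof
    assume ?group
    then obtain G :: "'a monoid" and b where "group G" and carr: "carrier G = \<Omega>"
      and b: "b \<in> \<Psi> \<rightarrow> \<Omega>" and eq: "\<forall>\<psi>\<in>\<Psi>. \<psi> = group_constraint k G (b \<psi>)"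
      by blast
    interpret group G by fact
    show ?sym
    proof
      fix F assume F: "F \<in> F2 k \<Omega> \<Psi>"
      \<comment> \<open>A function in \<open>F2\<close> comes with an outer constraint, and
        commutativity of that constraint makes the group abelian. For empty \<Psi> there is no such
        function and nothing to show.\<close>
      then obtain \<psi> where \<psi>: "\<psi> \<in> \<Psi>" unfolding F2_def by blast
      interpret comm_group G
      proof (rule comm_group_if_commutative_constraint)
        show "b \<psi> \<in> carrier G" using b \<psi> carr by auto
        show "commutative_constraint (Suc (Suc (Suc m))) (carrier G)
                (group_constraint (Suc (Suc (Suc m))) G (b \<psi>))"
          using assms(6)[OF \<psi>] eq \<psi> carr by (metis k)
      qed
      show "symmetric_fun ((k - 1)\<^sup>2) \<Omega> F"
        using F2_group_symmetric[of \<Psi> "k - 1" b F] assms(5) b eq F by (simp add: k carr)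
    qed
  next
    assume sym: ?sym
    show ?group
    proof (cases "\<Psi> = {}")
      case True
      then show ?thesis
        using exists_group_on_finite[OF \<open>finite \<Omega>\<close> \<open>\<Omega> \<noteq> {}\<close>] by auto
    next
      case False
      then obtain \<psi> z where "\<psi> \<in> \<Psi>" "z \<in> \<Omega>" using \<open>\<Omega> \<noteq> {}\<close> by blast
      then show ?thesis
        using group_if_F2_symmetric[of \<Psi> m \<Omega> \<psi> z] assms(5,6) sym by (simp add: k)
    qed
  qed
qed

end
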